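(* Let $X$ be a compact metric space, $G$ a finitely generated group and $T:G\times X\to X$ a continuous group action satisfying the specification property. Then the push-forward group action $T_\sharp:G\times\mathcal P(X)\to\mathcal P(X)$ satisfies the specification property.
   Context: Let $G$ be a finitely generated group with $G_1=\{id,g_1^{\pm1},\dots,g_m^{\pm1}\}$, and let $G_n$ be the set of products $g_{i_n}\cdots g_{i_1}$ with all $g_{i_j}\in G_1$. For $h,g\in G$ put $d_G(h,g)=|h^{-1}g|:=\inf\{n\ge1:h^{-1}g\in G_n\}$; for subsets $\Lambda,\Lambda'\subset G$, $d_G(\Lambda,\Lambda')=\inf\{d_G(h,g):h\in\Lambda,g\in\Lambda'\}$. Specification property of a continuous group action of $G$ on a compact metric space $(Y,d)$: for every $\delta>0$ there is $p(\delta)>0$ such that for any finite families $(\Lambda_i)_{i\in\mathcal I}$ of subsets of $G$ and $(x_i)_{i\in\mathcal I}$ of points of $Y$ with $d_G(\Lambda_i,\Lambda_j)>p(\delta)$ for all $i\ne j$, there is $x\in Y$ with $d(g_ix,g_ix_i)<\delta$ for every $i\in\mathcal I$ and every $g_i\in\Lambda_i$. $\mathcal P(X)$ is the space of Borel probability measures on $X$ with the weak$^*$ topology, metrized by $d_{\mathcal P}(\mu,\nu)=\sum_{k\ge1}\frac1{2^k\|\phi_k\|}\left|\int\phi_k\,d\mu-\int\phi_k\,d\nu\right|$, where $(\phi_k)_{k\ge1}$ is a fixed countable dense set of (nonzero) functions in $C(X)$. The push-forward action is $g\cdot\nu=T(g,\cdot)_\sharp\,\nu$. *)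

theory Defs
  imports "HOL-Probability.Probability" "HOL-Algebra.Algebra"
begin

definition unit_ball :: "('g, 'b) monoid_scheme \<Rightarrow> 'g set \<Rightarrow> 'g set" where
  "unit_ball G S = {\<one>\<^bsub>G\<^esub>} \<union> S \<union> (\<lambda>s. inv\<^bsub>G\<^esub> s) ` S"

definition word_ball :: "('g, 'b) monoid_scheme \<Rightarrow> 'g set \<Rightarrow> nat \<Rightarrow> 'g set" where
  "word_ball G S n =
     {foldr (\<lambda>a b. a \<otimes>\<^bsub>G\<^esub> b) ws \<one>\<^bsub>G\<^esub> | ws. length ws = n \<and> set ws \<subseteq> unit_ball G S}"

(* The infimum ranges over n >= 1, so the distance of an element to itself is 1 and not 0. *)
definition word_dist :: "('g, 'b) monoid_scheme \<Rightarrow> 'g set \<Rightarrow> 'g \<Rightarrow> 'g \<Rightarrow> ereal" where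
  "word_dist G S h g =
     (INF n\<in>{n::nat. 1 \<le> n \<and> inv\<^bsub>G\<^esub> h \<otimes>\<^bsub>G\<^esub> g \<in> word_ball G S n}. ereal (real n))"

(* The distance to the empty set is infinity, the infimum of the empty set in ereal. *)
definition word_setdist :: "('g, 'b) monoid_scheme \<Rightarrow> 'g set \<Rightarrow> 'g set \<Rightarrow> 'g set \<Rightarrow> ereal" where
  "word_setdist G S L L' = (INF h\<in>L. INF g\<in>L'. word_dist G S h g)"

(* Y is the phase space, d its metric and T g the map by which g acts on Y.  Finite families
   are indexed by finite sets of natural numbers, which covers all finite index sets. *)
definition specification_property ::
  "('g, 'b) monoid_scheme \<Rightarrow> 'g set \<Rightarrow> 'y set \<Rightarrow> ('y \<Rightarrow> 'y \<Rightarrow> real) \<Rightarrow> ('g \<Rightarrow> 'y \<Rightarrow> 'y) \<Rightarrow> bool" where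
  "specification_property G S Y d T \<longleftrightarrow>
     (\<forall>\<delta>>0. \<exists>p::real. p > 0 \<and>
       (\<forall>(I::nat set) (\<Lambda>::nat \<Rightarrow> 'g set) (x::nat \<Rightarrow> 'y).
          finite I \<longrightarrow>
          (\<forall>i\<in>I. \<Lambda> i \<subseteq> carrier G) \<longrightarrow>
          (\<forall>i\<in>I. x i \<in> Y) \<longrightarrow>
          (\<forall>i\<in>I. \<forall>j\<in>I. i \<noteq> j \<longrightarrow> word_setdist G S (\<Lambda> i) (\<Lambda> j) > ereal p) \<longrightarrow>
          (\<exists>y\<in>Y. \<forall>i\<in>I. \<forall>g\<in>\<Lambda> i. d (T g y) (T g (x i)) < \<delta>)))"

definition borel_probs :: "'a::topological_space measure set" where
  "borel_probs = {\<mu>. sets \<mu> = sets borel \<and> prob_space \<mu>}"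

(* phi k is the (k+1)-st function of the sequence, whence the weight 2 ^ (k + 1). *)
definition prob_dist ::
  "(nat \<Rightarrow> ('a::metric_space \<Rightarrow>\<^sub>C real)) \<Rightarrow> 'a measure \<Rightarrow> 'a measure \<Rightarrow> real" where
  "prob_dist \<phi> \<mu> \<nu> =
     suminf (\<lambda>k. 1 / (2 ^ (k + 1) * norm (\<phi> k)) *
        \<bar>(\<integral>x. apply_bcontfun (\<phi> k) x \<partial>\<mu>) - (\<integral>x. apply_bcontfun (\<phi> k) x \<partial>\<nu>)\<bar>)"

definition push_action :: "('g \<Rightarrow> 'a::topological_space \<Rightarrow> 'a) \<Rightarrow> 'g \<Rightarrow> 'a measure \<Rightarrow> 'a measure" where
  "push_action T g \<nu> = distr \<nu> borel (T g)"

end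

(* Given measures mu_i on X, put the product measure on X^I. For a tuple w = (w_i) the set of points
   y whose Lambda_i-orbit shadows that of w_i, for every i, is compact and nonempty by specification
   in X, so it has a measurable selection f. The law nu of f is coupled with every mu_i by
   w |-> (f w, w_i), and along this coupling g (f w) and g w_i are uniformly close for all g in
   Lambda_i. Finitely many phi_k decide the distance up to a small tail, and they are uniformly
   continuous. *)
theory Submission
  imports Defs "HOL-Real_Asymp.Real_Asymp"
begin

section \<open>Measurable selection for closed-valued maps into a compact metric space\<close>

lemma compact_dense_sequence:
  assumes "compact (UNIV :: 'a::metric_space set)"
  obtains c :: "nat \<Rightarrow> 'a::metric_space" where "\<forall>x. \<forall>e>0. \<exists>j. dist (c j) x < e"
proof -
  have "\<exists>N::'a set. finite N \<and> UNIV \<subseteq> (\<Union>x\<in>N. ball x (1 / real (Suc n)))" for n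
    using assms unfolding compact_eq_totally_bounded by (auto elim!: allE[of _ "1 / real (Suc n)"])
  then obtain N :: "nat \<Rightarrow> 'a set"
    where N: "\<And>n. finite (N n)" "\<And>n. UNIV \<subseteq> (\<Union>x\<in>N n. ball x (1 / real (Suc n)))"
    by metis
  define D where "D = (\<Union>n. N n)"
  have "countable D"
    unfolding D_def using N(1) by (auto intro: countable_finite)
  have close: "\<exists>y\<in>D. dist y x < e" if "e > 0" for x e
  proof -
    obtain n where n: "1 / real (Suc n) < e"
      using nat_approx_posE[OF \<open>e > 0\<close>] .
    obtain y where "y \<in> N n" "dist y x < 1 / real (Suc n)"
      using N(2)[of n] by (auto simp: subset_iff)
    then show ?thesis
      using n by (auto simp: D_def intro!: bexI[of _ y])
  qed
  then have "D \<noteq> {}"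
    by (metis equals0D zero_less_one)
  show ?thesis
  proof (rule that[of "from_nat_into D"], intro allI impI)
    fix x and e :: real assume "e > 0"
    then obtain y where "y \<in> D" "dist y x < e"
      using close by blast
    then show "\<exists>j. dist (from_nat_into D j) x < e"
      using from_nat_into_surj[OF \<open>countable D\<close>] by metis
  qed
qed

lemma compact_decseq_Inter_nonempty:
  fixes K :: "nat \<Rightarrow> 'a::metric_space set"
  assumes "compact (UNIV :: 'a set)" and "decseq K"
    and "\<And>n. closed (K n)" and "\<And>n. K n \<noteq> {}"
  shows "(\<Inter>n. K n) \<noteq> {}"
proof -
  obtain y where y: "\<And>n. y n \<in> K n"
    using assms(4) unfolding ex_in_conv[symmetric] by metis
  obtain l r where lr: "strict_mono r" "(y \<circ> r) \<longlonglongrightarrow> l"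
    using assms(1) unfolding compact_eq_seq_compact_metric seq_compact_def by (metis UNIV_I)
  have "l \<in> K m" for m
  proof (rule Lim_in_closed_set[OF assms(3) _ _ lr(2)])
    have "(y \<circ> r) n \<in> K m" if "m \<le> n" for n
      using y[of "r n"] that seq_suble[OF lr(1), of n] decseqD[OF assms(2), of m "r n"] by auto
    then show "\<forall>\<^sub>F n in sequentially. (y \<circ> r) n \<in> K m"
      by (auto simp: eventually_sequentially)
  qed simp
  then show ?thesis by blast
qed

text \<open>Successive approximation of a selected point. Each stage cuts the current set with the
  first ball of the sequence that meets it, and the radii tend to 0, so at most one point survives
  all stages. Taking the least index, not an arbitrary one, is what makes the choice depend
  measurably on \<open>w\<close>.\<close>

primrec ball_refinement :: "(nat \<Rightarrow> 'a::metric_space) \<Rightarrow> ('w \<Rightarrow> 'a set) \<Rightarrow> nat \<Rightarrow> 'w \<Rightarrow> 'a set" where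
  "ball_refinement c F 0 = F"
| "ball_refinement c F (Suc n) = (\<lambda>w. ball_refinement c F n w \<inter>
     cball (c (LEAST j. ball_refinement c F n w \<inter> cball (c j) (1 / real (Suc n)) \<noteq> {}))
       (1 / real (Suc n)))"

lemma closed_ball_refinement:
  assumes "closed (F w)" shows "closed (ball_refinement c F n w)"
  by (induction n) (use assms in auto)

lemma decseq_ball_refinement: "decseq (\<lambda>n. ball_refinement c F n w)"
  by (rule decseq_SucI) auto

lemma ball_refinement_nonempty:
  assumes dense: "\<forall>x. \<forall>e>0. \<exists>j. dist (c j) x < e" and "F w \<noteq> {}"
  shows "ball_refinement c F n w \<noteq> {}"
proof (induction n)
  case (Suc n)
  then obtain y where "y \<in> ball_refinement c F n w" by blast
  moreover obtain j where "dist (c j) y < 1 / real (Suc n)"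
    using dense[rule_format, of "1 / real (Suc n)" y] by auto
  ultimately have "ball_refinement c F n w \<inter> cball (c j) (1 / real (Suc n)) \<noteq> {}"
    by (auto simp del: of_nat_Suc intro!: exI[of _ y])
  from LeastI[of "\<lambda>j. ball_refinement c F n w \<inter> cball (c j) (1 / real (Suc n)) \<noteq> {}", OF this]
  show ?case by simp
qed (use assms in simp)

text \<open>Induction on the stage, for all closed \<open>C\<close> at once. The space splits into
  countably many measurable pieces according to which ball is chosen. On the piece of index
  \<open>j\<close> the refined set meets \<open>C\<close> iff the previous one meets
  \<open>B j \<inter> C\<close>, which is again closed because the balls are.\<close>

lemma ball_refinement_hits_closed:
  assumes dense: "\<forall>x. \<forall>e>0. \<exists>j. dist (c j) x < e"
    and ne: "\<And>w. w \<in> space M \<Longrightarrow> F w \<noteq> {}"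
    and hits: "\<And>C. closed C \<Longrightarrow> {w \<in> space M. F w \<inter> C \<noteq> {}} \<in> sets M"
    and "closed C"
  shows "{w \<in> space M. ball_refinement c F n w \<inter> C \<noteq> {}} \<in> sets M"
  using \<open>closed C\<close>
proof (induction n arbitrary: C)
  case 0
  then show ?case using hits by simp
next
  case (Suc n)
  define B where "B j = cball (c j) (1 / real (Suc n))" for j
  define H where "H C = {w \<in> space M. ball_refinement c F n w \<inter> C \<noteq> {}}" for C
  define J where "J w = (LEAST j. ball_refinement c F n w \<inter> B j \<noteq> {})" for w
  \<comment> \<open>\<open>D j\<close> collects the points at which \<open>B j\<close> is the first
    ball that is hit. As a difference of finitely many hitting sets it is measurable by the
    induction hypothesis.\<close>
  define D where "D j = H (B j) - (\<Union>i<j. H (B i))" for j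
  have H: "H C \<in> sets M" if "closed C" for C
    using Suc.IH[OF that] by (simp add: H_def)
  have [simp]: "closed (B j)" for j by (simp add: B_def)
  have D: "D j \<in> sets M" for j
    unfolding D_def by (intro sets.Diff sets.finite_UN H) auto
  \<comment> \<open>Nonemptiness of stage \<open>Suc n\<close> says precisely that the ball picked
    by \<open>LEAST\<close> is hit, so some ball is.\<close>
  have ex: "\<exists>j. ball_refinement c F n w \<inter> B j \<noteq> {}" if "w \<in> space M" for w
    using ball_refinement_nonempty[where F = F and w = w and n = "Suc n", OF dense ne[OF that]]
    by (auto simp: B_def)
  have J: "J w = j \<longleftrightarrow> w \<in> D j" if "w \<in> space M" for w j
  proof
    assume "J w = j"
    then show "w \<in> D j"
      using LeastI_ex[OF ex[OF that]] not_less_Least[of _ "\<lambda>j. ball_refinement c F n w \<inter> B j \<noteq> {}"] that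
      unfolding J_def D_def H_def by blast
  next
    assume *: "w \<in> D j"
    show "J w = j"
      unfolding J_def
      by (rule Least_equality) (use * that in \<open>auto simp: D_def H_def not_less[symmetric]\<close>)
  qed
  have "{w \<in> space M. ball_refinement c F (Suc n) w \<inter> C \<noteq> {}} =
      {w \<in> space M. ball_refinement c F n w \<inter> B (J w) \<inter> C \<noteq> {}}"
    by (simp add: B_def J_def)
  also have "\<dots> = (\<Union>j. D j \<inter> H (B j \<inter> C))"
  proof (rule Set.set_eqI)
    fix w
    show "w \<in> {w \<in> space M. ball_refinement c F n w \<inter> B (J w) \<inter> C \<noteq> {}} \<longleftrightarrow>
        w \<in> (\<Union>j. D j \<inter> H (B j \<inter> C))"
      by (cases "w \<in> space M") (auto simp: J[symmetric] H_def Int_assoc)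
  qed
  also have "\<dots> \<in> sets M"
    by (intro sets.countable_UN) (auto intro!: sets.Int D H closed_Int \<open>closed C\<close>)
  finally show ?case .
qed

text \<open>The compact case of the Kuratowski--Ryll-Nardzewski theorem. The library's measurability facts for metric spaces
  need the class \<open>second_countable_topology\<close>, which compactness of the whole type does not give.\<close>

lemma measurable_selection_compact:
  fixes F :: "'w \<Rightarrow> 'a::metric_space set"
  assumes compact: "compact (UNIV :: 'a set)"
    and cl: "\<And>w. w \<in> space M \<Longrightarrow> closed (F w)"
    and ne: "\<And>w. w \<in> space M \<Longrightarrow> F w \<noteq> {}"
    and hits: "\<And>C. closed C \<Longrightarrow> {w \<in> space M. F w \<inter> C \<noteq> {}} \<in> sets M"
  obtains f where "f \<in> borel_measurable M" and "\<And>w. w \<in> space M \<Longrightarrow> f w \<in> F w"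
proof -
  obtain c :: "nat \<Rightarrow> 'a" where dense: "\<forall>x. \<forall>e>0. \<exists>j. dist (c j) x < e"
    using compact_dense_sequence[OF compact] .
  let ?R = "ball_refinement c F"
  have "\<exists>y. \<forall>n. y \<in> ?R n w" if "w \<in> space M" for w
  proof -
    have "(\<Inter>n. ?R n w) \<noteq> {}"
      by (intro compact_decseq_Inter_nonempty[OF compact decseq_ball_refinement]
          closed_ball_refinement[where F = F] ball_refinement_nonempty[where F = F, OF dense]
          cl ne that)
    then show ?thesis by blast
  qed
  then have "\<exists>f. \<forall>w\<in>space M. \<forall>n. f w \<in> ?R n w"
    by (intro bchoice ballI)
  then obtain f where f: "\<And>w n. w \<in> space M \<Longrightarrow> f w \<in> ?R n w"
    by blast
  \<comment> \<open>Two points surviving all stages share a closed ball of radius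
    \<open>1 / real (Suc n)\<close> for every \<open>n\<close>.\<close>
  have unique: "y = f w" if w: "w \<in> space M" and y: "\<And>n. y \<in> ?R n w" for w y
  proof -
    have "dist y (f w) \<le> 2 / real (Suc n)" for n
    proof -
      let ?j = "LEAST j. ?R n w \<inter> cball (c j) (1 / real (Suc n)) \<noteq> {}"
      have "dist (c ?j) y \<le> 1 / real (Suc n)" "dist (c ?j) (f w) \<le> 1 / real (Suc n)"
        using y[of "Suc n"] f[OF w, of "Suc n"] by auto
      then show ?thesis
        using dist_triangle3[of y "f w" "c ?j"] by linarith
    qed
    moreover have "(\<lambda>n. 2 / real (Suc n)) \<longlonglongrightarrow> 0"
      by real_asymp
    ultimately have "dist y (f w) \<le> 0"
      using LIMSEQ_le_const by blast
    then show ?thesis by simp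
  qed
  have "f -` C \<inter> space M \<in> sets M" if C: "closed C" for C
  proof -
    \<comment> \<open>If every stage meets \<open>C\<close>, then by compactness the nested sets
      \<open>?R n w \<inter> C\<close> have a common point, and by uniqueness it is
      \<open>f w\<close>. The preimage of \<open>C\<close> thus becomes a countable intersection of
      hitting sets.\<close>
    have "f w \<in> C \<longleftrightarrow> (\<forall>n. ?R n w \<inter> C \<noteq> {})" if w: "w \<in> space M" for w
    proof
      assume "\<forall>n. ?R n w \<inter> C \<noteq> {}"
      then have "(\<Inter>n. ?R n w \<inter> C) \<noteq> {}"
        using w C decseq_ball_refinement[of c F w]
        by (intro compact_decseq_Inter_nonempty[OF compact])
          (auto simp: decseq_def intro!: closed_ball_refinement[where F = F] cl)
      then show "f w \<in> C"
        using unique[OF w] by blast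
    qed (use f[OF w] in blast)
    then have "f -` C \<inter> space M = (\<Inter>n. {w \<in> space M. ?R n w \<inter> C \<noteq> {}})"
      by auto
    also have "\<dots> \<in> sets M"
      using ball_refinement_hits_closed[where F = F and c = c and M = M, OF dense ne hits C]
      by (intro sets.countable_INT) auto
    finally show ?thesis .
  qed
  then have "f \<in> borel_measurable M"
    unfolding borel_eq_closed by (intro measurable_measure_of) auto
  then show ?thesis
    using that f[of _ 0] by auto
qed

section \<open>Measurability of closed sets in a finite power of the space\<close>

text \<open>Separability brings a closed set into the product sigma-algebra: its complement is a
  union of countably many products of balls with centers in a dense sequence, and each such box is
  measurable.\<close>

lemma sets_PiM_borel_seq_closed:
  fixes A :: "('i \<Rightarrow> 'a::metric_space) set"
  assumes compact: "compact (UNIV :: 'a set)" and "finite I" and A: "A \<subseteq> (\<Pi>\<^sub>E i\<in>I. UNIV)"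
    and seq: "\<And>u w. (\<And>n. u n \<in> A) \<Longrightarrow> w \<in> (\<Pi>\<^sub>E i\<in>I. UNIV) \<Longrightarrow>
      (\<And>i. i \<in> I \<Longrightarrow> (\<lambda>n::nat. u n i) \<longlonglongrightarrow> w i) \<Longrightarrow> w \<in> A"
  shows "A \<in> sets (\<Pi>\<^sub>M i\<in>I. borel)"
proof -
  obtain c :: "nat \<Rightarrow> 'a" where dense: "\<forall>x. \<forall>e>0. \<exists>j. dist (c j) x < e"
    using compact_dense_sequence[OF compact] .
  define box where "box = (\<lambda>(n, J). \<Pi>\<^sub>E i\<in>I. ball (c (J i)) (1 / real (Suc n)))"
  \<comment> \<open>The center indices are extensional functions on the finite set \<open>I\<close>,
    so there are only countably many boxes. This is why \<open>J\<close> is restricted to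
    \<open>I\<close> below.\<close>
  define P where "P = {p \<in> UNIV \<times> (\<Pi>\<^sub>E i\<in>I. UNIV). box p \<inter> A = {}}"
  have "countable P"
    unfolding P_def using \<open>finite I\<close>
    by (intro countable_subset[OF Collect_restrict] countable_SIGMA countable_PiE) auto
  have cover: "\<exists>p\<in>P. w \<in> box p" if w: "w \<in> (\<Pi>\<^sub>E i\<in>I. UNIV)" "w \<notin> A" for w
  proof -
    \<comment> \<open>Otherwise points of \<open>A\<close> converge to \<open>w\<close> in each
      coordinate, forcing \<open>w\<close> into \<open>A\<close>. The numerator 2 leaves room to
      move the centers: a box whose centers are within \<open>1 / real (Suc n)\<close> of
      \<open>w\<close> contains only points within \<open>2 / real (Suc n)\<close> of
      \<open>w\<close>.\<close>
    have "\<exists>n. \<forall>u\<in>A. \<exists>i\<in>I. dist (u i) (w i) \<ge> 2 / real (Suc n)"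
    proof (rule ccontr)
      assume "\<not> ?thesis"
      then obtain u where u: "\<And>n. u n \<in> A" "\<And>n i. i \<in> I \<Longrightarrow> dist (u n i) (w i) < 2 / real (Suc n)"
        by (metis not_le)
      have "(\<lambda>n. u n i) \<longlonglongrightarrow> w i" if "i \<in> I" for i
      proof (rule tendstoI)
        fix e :: real assume "e > 0"
        have "(\<lambda>n. 2 / real (Suc n)) \<longlonglongrightarrow> 0" by real_asymp
        then have "\<forall>\<^sub>F n in sequentially. 2 / real (Suc n) < e"
          using \<open>e > 0\<close> by (rule order_tendstoD)
        then show "\<forall>\<^sub>F n in sequentially. dist (u n i) (w i) < e"
          by eventually_elim (use u(2)[OF that] less_trans in blast)
      qed
      then have "w \<in> A" using seq u(1) w(1) by blast
      with w(2) show False by blast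
    qed
    then obtain n where n: "\<And>u. u \<in> A \<Longrightarrow> \<exists>i\<in>I. dist (u i) (w i) \<ge> 2 / real (Suc n)"
      by blast
    obtain j where j: "\<And>x. dist (c (j x)) x < 1 / real (Suc n)"
      using dense[rule_format, of "1 / real (Suc n)"] by (metis of_nat_0_less_iff zero_less_Suc zero_less_divide_1_iff)
    define J where "J = (\<lambda>i\<in>I. j (w i))"
    have "u \<notin> A" if u: "u \<in> box (n, J)" for u
    proof
      assume "u \<in> A"
      then obtain i where i: "i \<in> I" "dist (u i) (w i) \<ge> 2 / real (Suc n)"
        using n by blast
      have "dist (c (J i)) (u i) < 1 / real (Suc n)"
        using u i(1) by (auto simp: box_def PiE_iff)
      moreover have "dist (c (J i)) (w i) < 1 / real (Suc n)"
        using j[of "w i"] i(1) by (simp add: J_def)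
      ultimately have "dist (u i) (w i) < 1 / real (Suc n) + 1 / real (Suc n)"
        using dist_triangle3[of "u i" "w i" "c (J i)"] by linarith
      with i(2) show False by (simp add: field_simps)
    qed
    then have "(n, J) \<in> P" by (auto simp: P_def J_def)
    moreover have "w \<in> box (n, J)"
      using w(1) j by (auto simp: box_def J_def PiE_iff simp del: of_nat_Suc)
    ultimately show ?thesis by blast
  qed
  have "A = space (\<Pi>\<^sub>M i\<in>I. borel) - (\<Union>p\<in>P. box p)"
  proof (intro equalityI subsetI)
    fix w assume "w \<in> A"
    then show "w \<in> space (\<Pi>\<^sub>M i\<in>I. borel) - (\<Union>p\<in>P. box p)"
      using A unfolding space_PiM space_borel P_def by blast
  next
    fix w assume "w \<in> space (\<Pi>\<^sub>M i\<in>I. borel) - (\<Union>p\<in>P. box p)"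
    then show "w \<in> A"
      using cover[of w] unfolding space_PiM space_borel by blast
  qed
  moreover have "box p \<in> sets (\<Pi>\<^sub>M i\<in>I. borel)" for p
    using \<open>finite I\<close> by (auto simp: box_def split: prod.splits intro!: sets_PiM_I_finite)
  ultimately show ?thesis
    using \<open>countable P\<close> by (metis sets.Diff sets.countable_UN'' sets.top)
qed

text \<open>The set is the projection of a closed relation between \<open>y\<close> and
  \<open>w\<close> along a compact factor, hence closed: shadowing points of a convergent sequence
  of tuples subconverge, and the non-strict bound passes to the limit. The limit is taken for one
  \<open>g\<close> at a time, so \<open>\<Lambda> i\<close> may be infinite.\<close>

lemma shadowing_set_measurable:
  fixes T :: "'g \<Rightarrow> 'a::metric_space \<Rightarrow> 'a"
  assumes compact: "compact (UNIV :: 'a set)" and "finite I" and "closed C"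
    and cont: "\<And>i g. i \<in> I \<Longrightarrow> g \<in> \<Lambda> i \<Longrightarrow> continuous_on UNIV (T g)"
  shows "{w \<in> \<Pi>\<^sub>E i\<in>I. UNIV. {y. \<forall>i\<in>I. \<forall>g\<in>\<Lambda> i. dist (T g y) (T g (w i)) \<le> e} \<inter> C \<noteq> {}}
    \<in> sets (\<Pi>\<^sub>M i\<in>I. borel)" (is "?A \<in> _")
proof (rule sets_PiM_borel_seq_closed[OF compact \<open>finite I\<close>])
  fix u w
  assume u: "\<And>n::nat. u n \<in> ?A" and w: "w \<in> (\<Pi>\<^sub>E i\<in>I. UNIV)"
    and lim: "\<And>i. i \<in> I \<Longrightarrow> (\<lambda>n. u n i) \<longlonglongrightarrow> w i"
  have "\<exists>y. y \<in> C \<and> (\<forall>i\<in>I. \<forall>g\<in>\<Lambda> i. dist (T g y) (T g (u n i)) \<le> e)" for n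
    using u[of n] by blast
  then obtain y where y: "\<And>n. y n \<in> C"
      "\<And>n i g. i \<in> I \<Longrightarrow> g \<in> \<Lambda> i \<Longrightarrow> dist (T g (y n)) (T g (u n i)) \<le> e"
    by metis
  obtain l r where lr: "strict_mono r" "(y \<circ> r) \<longlonglongrightarrow> l"
    using compact unfolding compact_eq_seq_compact_metric seq_compact_def by (metis UNIV_I)
  have "l \<in> C"
    using closed_sequentially[OF \<open>closed C\<close> _ lr(2)] y(1) by simp
  moreover have "dist (T g l) (T g (w i)) \<le> e" if ig: "i \<in> I" "g \<in> \<Lambda> i" for i g
  proof (rule LIMSEQ_le_const2)
    have T: "(\<lambda>n. T g (v n)) \<longlonglongrightarrow> T g x" if "v \<longlonglongrightarrow> x" for v x
      using continuous_on_tendsto_compose[OF cont[OF ig] that] by simp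
    show "(\<lambda>n. dist (T g ((y \<circ> r) n)) (T g (((\<lambda>n. u n i) \<circ> r) n))) \<longlonglongrightarrow> dist (T g l) (T g (w i))"
      by (intro tendsto_dist T lr LIMSEQ_subseq_LIMSEQ lim ig)
  qed (use y(2)[OF ig] in auto)
  ultimately show "w \<in> ?A" using w by blast
qed auto

section \<open>Estimates for the metric on probability measures\<close>

text \<open>The tolerance varies with \<open>k\<close> because \<open>prob_dist\<close> divides its
  terms by \<open>norm (\<phi> k)\<close>.\<close>

lemma bcontfun_finite_uniform_modulus:
  fixes \<phi> :: "nat \<Rightarrow> ('a::metric_space \<Rightarrow>\<^sub>C real)"
  assumes "compact (UNIV :: 'a set)" and "\<And>k. k < K \<Longrightarrow> r k > 0"
  shows "\<exists>d>0. \<forall>k<K. \<forall>x y. dist x y < d \<longrightarrow> dist (\<phi> k x) (\<phi> k y) < r k"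
  using assms(2)
proof (induction K)
  case (Suc K)
  then obtain d where d: "d > 0" "\<forall>k<K. \<forall>x y. dist x y < d \<longrightarrow> dist (\<phi> k x) (\<phi> k y) < r k"
    by auto
  have "uniformly_continuous_on UNIV (apply_bcontfun (\<phi> K))"
    using assms(1) by (intro compact_uniformly_continuous continuous_on_apply_bcontfun continuous_on_id)
  then obtain d' where d': "d' > 0" "\<And>x y. dist x y < d' \<Longrightarrow> dist (\<phi> K x) (\<phi> K y) < r K"
    using Suc.prems[of K] unfolding uniformly_continuous_on_def by (metis UNIV_I lessI)
  show ?case
    using d d' by (intro exI[of _ "min d d'"]) (auto simp: less_Suc_eq)
qed (auto intro: exI[of _ 1])

text \<open>The weights \<open>1 / 2 ^ (k + 1)\<close> sum to 1, so the first \<open>K\<close> terms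
  contribute at most \<open>e\<close>. From index \<open>K\<close> on they sum to
  \<open>1 / 2 ^ K\<close>, and the crude bound \<open>all\<close> supplies the factor 2.\<close>

lemma prob_dist_le:
  fixes \<phi> :: "nat \<Rightarrow> ('a::metric_space \<Rightarrow>\<^sub>C real)"
  assumes nz: "\<And>k. \<phi> k \<noteq> 0" and "e \<ge> 0"
    and near: "\<And>k. k < K \<Longrightarrow> \<bar>(\<integral>x. \<phi> k x \<partial>\<mu>) - (\<integral>x. \<phi> k x \<partial>\<nu>)\<bar> \<le> e * norm (\<phi> k)"
    and all: "\<And>k. \<bar>(\<integral>x. \<phi> k x \<partial>\<mu>) - (\<integral>x. \<phi> k x \<partial>\<nu>)\<bar> \<le> 2 * norm (\<phi> k)"
  shows "prob_dist \<phi> \<mu> \<nu> \<le> e + 2 / 2 ^ K"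
proof -
  define t where "t k = 1 / (2 ^ (k + 1) * norm (\<phi> k)) *
    \<bar>(\<integral>x. \<phi> k x \<partial>\<mu>) - (\<integral>x. \<phi> k x \<partial>\<nu>)\<bar>" for k
  \<comment> \<open>Used with \<open>a = e\<close> for the head and with \<open>a = 2\<close> for
    summability and the tail.\<close>
  have t_le: "t k \<le> a * (1 / 2) ^ Suc k"
    if "\<bar>(\<integral>x. \<phi> k x \<partial>\<mu>) - (\<integral>x. \<phi> k x \<partial>\<nu>)\<bar> \<le> a * norm (\<phi> k)" for k a
  proof -
    have "t k \<le> 1 / (2 ^ (k + 1) * norm (\<phi> k)) * (a * norm (\<phi> k))"
      unfolding t_def by (intro mult_left_mono that) auto
    also have "\<dots> = a * (1 / 2) ^ Suc k"
      using nz[of k] by (simp add: field_simps)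
    finally show ?thesis .
  qed
  have t_nonneg: "0 \<le> t k" for k by (simp add: t_def)
  have summ: "summable t"
    by (rule summable_comparison_test_ev[of _ "\<lambda>k. 2 * (1 / 2) ^ Suc k"])
      (use t_nonneg t_le[OF all] in \<open>auto intro!: summable_mult summable_geometric\<close>)
  have head: "(\<Sum>k<K. t k) \<le> e"
  proof -
    have "(\<Sum>k<K. t k) \<le> (\<Sum>k<K. e * (1 / 2) ^ Suc k)"
      by (intro sum_mono t_le near) auto
    also have "\<dots> = e * (\<Sum>k<K. (1 / 2) ^ Suc k)"
      by (simp add: sum_distrib_left)
    also have "\<dots> \<le> e * suminf (\<lambda>k. (1 / 2) ^ Suc k)"
      using power_half_series
      by (intro mult_left_mono sum_le_suminf \<open>e \<ge> 0\<close>) (auto simp: sums_iff)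
    also have "\<dots> = e"
      using power_half_series by (simp add: sums_iff)
    finally show ?thesis .
  qed
  have sums: "(\<lambda>k. 2 / 2 ^ K * (1 / 2) ^ Suc k) sums (2 / 2 ^ K * 1 :: real)"
    by (intro sums_mult power_half_series)
  \<comment> \<open>Shifting the index by \<open>K\<close> takes the factor \<open>1 / 2 ^ K\<close>
    out of the weights.\<close>
  have "suminf (\<lambda>k. t (k + K)) \<le> suminf (\<lambda>k. 2 / 2 ^ K * (1 / 2) ^ Suc k)"
  proof (rule suminf_le)
    show "t (k + K) \<le> 2 / 2 ^ K * (1 / 2) ^ Suc k" for k
      using t_le[OF all[of "k + K"]] by (simp add: power_add field_simps)
    show "summable (\<lambda>k. t (k + K))"
      using summ by (rule summable_ignore_initial_segment)
    show "summable (\<lambda>k. 2 / 2 ^ K * (1 / 2) ^ Suc k :: real)"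
      using sums by (rule sums_summable)
  qed
  then have "suminf (\<lambda>k. t (k + K)) \<le> 2 / 2 ^ K"
    using sums by (simp add: sums_iff)
  moreover have "prob_dist \<phi> \<mu> \<nu> = suminf t"
    unfolding prob_dist_def t_def ..
  ultimately show ?thesis
    using head suminf_split_initial_segment[OF summ, of K] by linarith
qed

text \<open>The pair \<open>(u, v)\<close> is a coupling of the two laws: both integrals become
  integrals over \<open>M\<close>, and their difference is at most the uniform distance of the
  integrands.\<close>

lemma prob_dist_distr_le:
  fixes \<phi> :: "nat \<Rightarrow> ('a::metric_space \<Rightarrow>\<^sub>C real)"
  assumes "prob_space M" and nz: "\<And>k. \<phi> k \<noteq> 0" and "e \<ge> 0"
    and u: "u \<in> borel_measurable M" and v: "v \<in> borel_measurable M"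
    and near: "\<And>k w. k < K \<Longrightarrow> w \<in> space M \<Longrightarrow> dist (\<phi> k (u w)) (\<phi> k (v w)) \<le> e * norm (\<phi> k)"
  shows "prob_dist \<phi> (distr M borel u) (distr M borel v) \<le> e + 2 / 2 ^ K"
proof -
  interpret prob_space M by fact
  have meas: "(\<lambda>w. \<phi> k (h w)) \<in> borel_measurable M" if "h \<in> borel_measurable M" for h k
    by (rule measurable_compose[OF that])
      (intro borel_measurable_continuous_onI continuous_on_apply_bcontfun continuous_on_id)
  have int: "integrable M (\<lambda>w. \<phi> k (h w))" if "h \<in> borel_measurable M" for h k
    by (rule integrable_const_bound[of _ "norm (\<phi> k)"]) (use meas[OF that] norm_bounded[of "\<phi> k"] in auto)
  have eq: "(\<integral>x. \<phi> k x \<partial>distr M borel h) = (\<integral>w. \<phi> k (h w) \<partial>M)" if "h \<in> borel_measurable M" for h k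
    by (intro integral_distr that borel_measurable_continuous_onI continuous_on_apply_bcontfun
        continuous_on_id)
  have bound: "\<bar>(\<integral>x. \<phi> k x \<partial>distr M borel u) - (\<integral>x. \<phi> k x \<partial>distr M borel v)\<bar> \<le> a"
    if "\<And>w. w \<in> space M \<Longrightarrow> dist (\<phi> k (u w)) (\<phi> k (v w)) \<le> a" for k a
  proof -
    have "\<bar>(\<integral>x. \<phi> k x \<partial>distr M borel u) - (\<integral>x. \<phi> k x \<partial>distr M borel v)\<bar>
        = norm (\<integral>w. \<phi> k (u w) - \<phi> k (v w) \<partial>M)"
      by (simp add: eq u v int)
    also have "\<dots> \<le> (\<integral>w. norm (\<phi> k (u w) - \<phi> k (v w)) \<partial>M)"
      by (rule integral_norm_bound)
    also have "\<dots> \<le> a"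
      by (rule integral_le_const)
        (use that in \<open>auto simp: int u v dist_real_def intro!: integrable_abs Bochner_Integration.integrable_diff\<close>)
    finally show ?thesis .
  qed
  show ?thesis
  proof (rule prob_dist_le[OF nz \<open>e \<ge> 0\<close>])
    fix k
    have "dist (\<phi> k x) (\<phi> k y) \<le> 2 * norm (\<phi> k)" for x y
      using norm_bounded[of "\<phi> k" x] norm_bounded[of "\<phi> k" y] by (simp add: dist_real_def)
    then show "\<bar>(\<integral>x. \<phi> k x \<partial>distr M borel u) - (\<integral>x. \<phi> k x \<partial>distr M borel v)\<bar> \<le> 2 * norm (\<phi> k)"
      by (intro bound)
  qed (intro bound near)
qed

section \<open>From shadowing of points to shadowing of measures\<close>

theorem theorem2p2:
  fixes G :: "('g, 'b) monoid_scheme"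
    and S :: "'g set"
    and T :: "'g \<Rightarrow> 'a::metric_space \<Rightarrow> 'a"
    and \<phi> :: "nat \<Rightarrow> ('a \<Rightarrow>\<^sub>C real)"
  assumes "compact (UNIV :: 'a set)"
    and "group G"
    and "finite S" and "S \<subseteq> carrier G" and "generate G S = carrier G"
    and "group_action G (UNIV :: 'a set) T"
    and "continuous_map (prod_topology (discrete_topology (carrier G)) euclidean) euclidean
           (\<lambda>(g, x). T g x)"
    and "\<And>k. \<phi> k \<noteq> 0" and "closure (range \<phi>) = UNIV"
    and "specification_property G S UNIV dist T"
  shows "specification_property G S borel_probs (prob_dist \<phi>) (push_action T)"
  unfolding specification_property_def
proof (intro allI impI)
  note compact = assms(1)
  have cont: "continuous_on UNIV (T g)" if "g \<in> carrier G" for g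
  proof -
    have "continuous_map euclidean (prod_topology (discrete_topology (carrier G)) euclidean)
        (\<lambda>x::'a. (g, x))"
      using that by (auto intro: continuous_map_pairedI)
    from continuous_map_compose[OF this assms(7)] show ?thesis
      by (simp add: o_def)
  qed
  fix \<delta> :: real assume "\<delta> > 0"
  \<comment> \<open>The budget for \<open>\<delta>\<close>: a quarter for the first \<open>K\<close>
    functions and less than a half for the tail.\<close>
  obtain K where K: "(1 / 2) ^ K < \<delta> / 4"
    using real_arch_pow_inv[of "\<delta> / 4" "1 / 2"] \<open>\<delta> > 0\<close> by auto
  have small: "\<delta> / 4 + 2 / 2 ^ K < \<delta>"
    using K \<open>\<delta> > 0\<close> by (simp add: power_one_over field_simps)
  obtain d where "d > 0"
    and d: "\<And>k x y. k < K \<Longrightarrow> dist x y < d \<Longrightarrow> dist (\<phi> k x) (\<phi> k y) < \<delta> / 4 * norm (\<phi> k)"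
    using bcontfun_finite_uniform_modulus[OF compact, of K "\<lambda>k. \<delta> / 4 * norm (\<phi> k)" \<phi>]
      assms(8) \<open>\<delta> > 0\<close> by auto
  \<comment> \<open>Half of \<open>d\<close> is requested so that the strict bound can be relaxed to
    \<open>\<le> d / 2\<close>, which makes the shadowing sets closed, and still yield
    \<open>< d\<close>. This \<open>p\<close> also serves for the measures.\<close>
  then obtain p where "p > 0" and p: "\<And>(I::nat set) \<Lambda> x. finite I \<Longrightarrow> (\<forall>i\<in>I. \<Lambda> i \<subseteq> carrier G) \<Longrightarrow>
      (\<forall>i\<in>I. \<forall>j\<in>I. i \<noteq> j \<longrightarrow> word_setdist G S (\<Lambda> i) (\<Lambda> j) > ereal p) \<Longrightarrow>
      (\<exists>y. \<forall>i\<in>I. \<forall>g\<in>\<Lambda> i. dist (T g y) (T g (x i)) < d / 2)"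
    using assms(10)[unfolded specification_property_def, rule_format, of "d / 2"] by auto
  show "\<exists>p>0. \<forall>(I::nat set) \<Lambda> \<mu>. finite I \<longrightarrow> (\<forall>i\<in>I. \<Lambda> i \<subseteq> carrier G) \<longrightarrow>
      (\<forall>i\<in>I. \<mu> i \<in> borel_probs) \<longrightarrow>
      (\<forall>i\<in>I. \<forall>j\<in>I. i \<noteq> j \<longrightarrow> word_setdist G S (\<Lambda> i) (\<Lambda> j) > ereal p) \<longrightarrow>
      (\<exists>\<nu>\<in>borel_probs. \<forall>i\<in>I. \<forall>g\<in>\<Lambda> i.
        prob_dist \<phi> (push_action T g \<nu>) (push_action T g (\<mu> i)) < \<delta>)"
  proof (intro exI[of _ p] conjI \<open>p > 0\<close> allI impI)
    fix I :: "nat set" and \<Lambda> and \<mu> :: "nat \<Rightarrow> 'a measure"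
    assume "finite I" and \<Lambda>: "\<forall>i\<in>I. \<Lambda> i \<subseteq> carrier G" and \<mu>: "\<forall>i\<in>I. \<mu> i \<in> borel_probs"
      and far: "\<forall>i\<in>I. \<forall>j\<in>I. i \<noteq> j \<longrightarrow> word_setdist G S (\<Lambda> i) (\<Lambda> j) > ereal p"
    define M where "M = Pi\<^sub>M I \<mu>"
    have \<mu>_prob: "prob_space (\<mu> i)" and \<mu>_sets: "sets (\<mu> i) = sets borel" if "i \<in> I" for i
      using \<mu> that by (auto simp: borel_probs_def)
    interpret M: prob_space M
      unfolding M_def by (intro prob_space_PiM \<mu>_prob)
    have sets_M: "sets M = sets (\<Pi>\<^sub>M i\<in>I. borel)"
      unfolding M_def by (intro sets_PiM_cong \<mu>_sets refl)
    have space_M: "space M = (\<Pi>\<^sub>E i\<in>I. UNIV)"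
      using sets_eq_imp_space_eq[OF sets_M] by (simp add: space_PiM)
    define F where "F w = {y. \<forall>i\<in>I. \<forall>g\<in>\<Lambda> i. dist (T g y) (T g (w i)) \<le> d / 2}" for w :: "nat \<Rightarrow> 'a"
    have F_closed: "closed (F w)" for w
      unfolding F_def Collect_ball_eq Collect_all_eq using \<Lambda>
      by (intro closed_INT ballI closed_Collect_le continuous_intros cont) auto
    \<comment> \<open>The separation condition concerns only the sets \<open>\<Lambda> i\<close>, so
      specification applies to every tuple \<open>w\<close> with the same \<open>p\<close>.\<close>
    have F_nonempty: "F w \<noteq> {}" for w
    proof -
      obtain y where "\<forall>i\<in>I. \<forall>g\<in>\<Lambda> i. dist (T g y) (T g (w i)) < d / 2"
        using p[OF \<open>finite I\<close> \<Lambda> far] by blast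
      then have "y \<in> F w" by (simp add: F_def less_imp_le)
      then show ?thesis by blast
    qed
    have F_hits: "{w \<in> space M. F w \<inter> C \<noteq> {}} \<in> sets M" if "closed C" for C
      unfolding space_M sets_M F_def using \<Lambda>
      by (intro shadowing_set_measurable compact \<open>finite I\<close> that cont) auto
    obtain f where f: "f \<in> borel_measurable M" "\<And>w. w \<in> space M \<Longrightarrow> f w \<in> F w"
      using measurable_selection_compact[where F = F and M = M, OF compact F_closed F_nonempty F_hits]
      by blast
    show "\<exists>\<nu>\<in>borel_probs. \<forall>i\<in>I. \<forall>g\<in>\<Lambda> i.
        prob_dist \<phi> (push_action T g \<nu>) (push_action T g (\<mu> i)) < \<delta>"
    proof (intro bexI[of _ "distr M borel f"] ballI)
      show "distr M borel f \<in> borel_probs"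
        using f(1) by (simp add: borel_probs_def M.prob_space_distr)
      fix i g assume i: "i \<in> I" and g: "g \<in> \<Lambda> i"
      have Tg: "T g \<in> borel_measurable borel"
        using \<Lambda> i g by (intro borel_measurable_continuous_onI cont) auto
      have coord: "(\<lambda>w. w i) \<in> borel_measurable M"
        unfolding measurable_cong_sets[OF sets_M refl] using i by simp
      \<comment> \<open>The \<open>i\<close>-th marginal of the product is \<open>\<mu> i\<close>.
        Hence both pushed measures are laws of maps on the same space \<open>M\<close>, as the
        coupling estimate requires.\<close>
      have "\<mu> i = distr M (\<mu> i) (\<lambda>w. w i)"
        using distr_PiM_component[of I \<mu> i] \<mu>_prob i by (simp add: M_def)
      also have "\<dots> = distr M borel (\<lambda>w. w i)"
        using \<mu>_sets[OF i] by (intro distr_cong) auto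
      finally have "push_action T g (\<mu> i) = distr M borel (\<lambda>w. T g (w i))"
        using distr_distr[OF Tg coord] by (simp add: push_action_def o_def)
      moreover have "push_action T g (distr M borel f) = distr M borel (\<lambda>w. T g (f w))"
        using distr_distr[OF Tg f(1)] by (simp add: push_action_def o_def)
      moreover have "prob_dist \<phi> (distr M borel (\<lambda>w. T g (f w))) (distr M borel (\<lambda>w. T g (w i)))
          \<le> \<delta> / 4 + 2 / 2 ^ K"
      proof (rule prob_dist_distr_le[OF M.prob_space_axioms assms(8)])
        fix k w assume "k < K" "w \<in> space M"
        then have "dist (T g (f w)) (T g (w i)) < d"
          using f(2)[of w] i g \<open>d > 0\<close> by (force simp: F_def)
        then show "dist (\<phi> k (T g (f w))) (\<phi> k (T g (w i))) \<le> \<delta> / 4 * norm (\<phi> k)"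
          using d[OF \<open>k < K\<close>] by (simp add: less_imp_le)
      qed (use \<open>\<delta> > 0\<close> Tg coord f(1) in \<open>auto intro: measurable_compose\<close>)
      ultimately show "prob_dist \<phi> (push_action T g (distr M borel f)) (push_action T g (\<mu> i)) < \<delta>"
        using small by simp
    qed
  qed
qed

end
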